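(* Let $\mu=\sum_{i=1}^6a_i\delta_{\lambda_i}$ be a probability measure with exactly $6$ atoms, where $a_i>0$ and $0<\lambda_1<\lambda_2<\cdots<\lambda_6$. I) If $\lambda_2^2=\lambda_1\lambda_4$ and $\lambda_5^2=\lambda_4\lambda_6$, then the following are equivalent: (1) $\mu*t\mu$ has a square root; (2) $\lambda_3^2=\lambda_1\lambda_6$ and $(a_2^2,a_3^2,a_5^2)=(4a_1a_4,\,4a_1a_6,\,4a_4a_6)$; (3) $\mu$ has a square root. II) If $\lambda_2^2=\lambda_1\lambda_3$ and $\lambda_5^2=\lambda_3\lambda_6$, then the following are equivalent: (1) $\mu*t\mu$ has a square root; (2) $\lambda_4^2=\lambda_1\lambda_6$ and $(a_2^2,a_4^2,a_5^2)=(4a_1a_3,\,4a_1a_6,\,4a_3a_6)$; (3) $\mu$ has a square root.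
   Context: $\delta_x$ is the Dirac measure at $x$. For two measures on $\mathbb{R}$, the multiplicative convolution is $[\nu*\mu](A)=\int_{\mathbb{R}}\int_{\mathbb{R}}\chi_A(xy)\,d\nu(x)\,d\mu(y)$. The measure $t\mu$ is defined by $d(t\mu)(t)=t\,d\mu(t)$, i.e. $t\mu=\sum_i a_i\lambda_i\delta_{\lambda_i}$. A nonnegative measure $\eta$ has a square root if there is a nonnegative measure $\nu$, supported in $[0,\infty)$, with $\nu*\nu=\eta$. *)

theory Defs
  imports "HOL-Probability.Probability"
begin

text \<open>The finite sum of weighted Dirac measures \<open>\<Sum>i\<in>I. a i \<delta>(x i)\<close> on the Borel sets of
  the real line, where \<^term>\<open>return borel x\<close> is the Dirac measure at \<open>x\<close>. The weights are meant
  to be nonnegative.\<close>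

definition dirac_comb :: "'i set \<Rightarrow> ('i \<Rightarrow> real) \<Rightarrow> ('i \<Rightarrow> real) \<Rightarrow> real measure" where
  "dirac_comb I a x =
     measure_of UNIV (sets borel) (\<lambda>A. \<Sum>i\<in>I. ennreal (a i) * emeasure (return borel (x i)) A)"

text \<open>Multiplicative convolution, formed like the library's additive \<^const>\<open>convolution\<close>. The
  formula by the double integral is \<open>emeasure_mult_convolution\<close> below.\<close>

definition mult_convolution :: "real measure \<Rightarrow> real measure \<Rightarrow> real measure" where
  "mult_convolution N M = distr (N \<Otimes>\<^sub>M M) borel (\<lambda>(x, y). x * y)"

text \<open>The measure \<open>t\<mu>\<close>. Since \<^const>\<open>ennreal\<close> truncates negative numbers to \<open>0\<close>, this is the
  intended measure only if \<open>M\<close> is supported in \<open>[0,\<infinity>)\<close>.\<close>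

definition t_measure :: "real measure \<Rightarrow> real measure" where
  "t_measure M = density M (\<lambda>t. ennreal t)"

text \<open>No finiteness of the root has to be demanded: if its square is a nonzero finite measure,
  then the total mass of the root is finite.\<close>

definition has_square_root :: "real measure \<Rightarrow> bool" where
  "has_square_root E \<longleftrightarrow>
     (\<exists>N :: real measure. sets N = sets borel \<and> emeasure N {..<0} = 0 \<and> mult_convolution N N = E)"

lemma sets_dirac_comb [simp, measurable_cong]: "sets (dirac_comb I a x) = sets borel"
  using sets.sigma_sets_eq[of "borel :: real measure"] by (simp add: dirac_comb_def)

lemma emeasure_dirac_comb:
  assumes "A \<in> sets borel"
  shows "emeasure (dirac_comb I a x) A = (\<Sum>i\<in>I. ennreal (a i) * emeasure (return borel (x i)) A)"
proof (rule emeasure_measure_of[OF dirac_comb_def])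
  show "countably_additive (sets (dirac_comb I a x))
          (\<lambda>A. \<Sum>i\<in>I. ennreal (a i) * emeasure (return borel (x i)) A)"
  proof (rule countably_additiveI)
    fix F :: "nat \<Rightarrow> real set"
    assume F: "range F \<subseteq> sets (dirac_comb I a x)" "disjoint_family F"
    have "(\<Sum>n. \<Sum>i\<in>I. ennreal (a i) * emeasure (return borel (x i)) (F n)) =
          (\<Sum>i\<in>I. \<Sum>n. ennreal (a i) * emeasure (return borel (x i)) (F n))"
      by (rule suminf_sum) simp
    also have "\<dots> = (\<Sum>i\<in>I. ennreal (a i) * emeasure (return borel (x i)) (\<Union>n. F n))"
    proof (rule sum.cong[OF refl])
      fix i
      have "(\<Sum>n. emeasure (return borel (x i)) (F n)) = emeasure (return borel (x i)) (\<Union>n. F n)"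
        using F by (intro suminf_emeasure) auto
      then show "(\<Sum>n. ennreal (a i) * emeasure (return borel (x i)) (F n)) =
                 ennreal (a i) * emeasure (return borel (x i)) (\<Union>n. F n)"
        by (simp only: ennreal_suminf_cmult)
    qed
    finally show "(\<Sum>n. \<Sum>i\<in>I. ennreal (a i) * emeasure (return borel (x i)) (F n)) =
      (\<Sum>i\<in>I. ennreal (a i) * emeasure (return borel (x i)) (\<Union>n. F n))" .
  qed
qed (use assms in \<open>auto simp: positive_def\<close>)

lemma emeasure_mult_convolution:
  assumes "sigma_finite_measure N" "sigma_finite_measure M"
    and sets [measurable_cong]: "sets N = sets borel" "sets M = sets borel"
    and A [measurable]: "A \<in> sets borel"
  shows "emeasure (mult_convolution N M) A = (\<integral>\<^sup>+y. \<integral>\<^sup>+x. indicator A (x * y) \<partial>N \<partial>M)"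
proof -
  interpret N: sigma_finite_measure N by fact
  interpret M: sigma_finite_measure M by fact
  interpret pair_sigma_finite N M ..
  have "emeasure (mult_convolution N M) A = (\<integral>\<^sup>+z. indicator A z \<partial>mult_convolution N M)"
    by (simp add: mult_convolution_def)
  also have "\<dots> = (\<integral>\<^sup>+z. indicator A (fst z * snd z) \<partial>(N \<Otimes>\<^sub>M M))"
    unfolding mult_convolution_def by (subst nn_integral_distr) (simp_all add: case_prod_beta)
  also have "\<dots> = (\<integral>\<^sup>+y. \<integral>\<^sup>+x. indicator A (x * y) \<partial>N \<partial>M)"
    by (subst nn_integral_snd[symmetric]) simp_all
  finally show ?thesis .
qed

lemma t_measure_dirac_comb:
  assumes "\<And>i. i \<in> I \<Longrightarrow> 0 \<le> a i"
  shows "t_measure (dirac_comb I a x) = dirac_comb I (\<lambda>i. a i * x i) x"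
proof (rule measure_eqI)
  fix A assume "A \<in> sets (t_measure (dirac_comb I a x))"
  then have A [measurable]: "A \<in> sets borel"
    by (simp add: t_measure_def)
  have nn: "(\<integral>\<^sup>+t. f t \<partial>dirac_comb I a x) = (\<Sum>i\<in>I. ennreal (a i) * f (x i))"
    if [measurable]: "f \<in> borel_measurable borel" for f :: "real \<Rightarrow> ennreal"
    using that
  proof (induction rule: borel_measurable_induct)
    case (cong f g)
    then show ?case by (simp cong: nn_integral_cong)
  next
    case (set B)
    then show ?case by (simp add: emeasure_dirac_comb)
  next
    case (mult u c)
    then show ?case by (simp add: nn_integral_cmult sum_distrib_left mult.left_commute)
  next
    case (add u v)
    then show ?case by (simp add: nn_integral_add distrib_left sum.distrib)
  next
    case (seq U)
    have "(\<integral>\<^sup>+t. (SUP n. U n) t \<partial>dirac_comb I a x) = (SUP n. \<integral>\<^sup>+t. U n t \<partial>dirac_comb I a x)"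
      using seq by (simp add: image_comp nn_integral_monotone_convergence_SUP)
    also have "\<dots> = (SUP n. \<Sum>i\<in>I. ennreal (a i) * U n (x i))"
      using seq by simp
    also have "\<dots> = (\<Sum>i\<in>I. SUP n. ennreal (a i) * U n (x i))"
      using seq by (intro ennreal_SUP_sum) (auto simp: incseq_def le_fun_def intro!: mult_left_mono)
    also have "\<dots> = (\<Sum>i\<in>I. ennreal (a i) * (SUP n. U n) (x i))"
      by (simp add: SUP_mult_left_ennreal image_comp)
    finally show ?case .
  qed
  show "emeasure (t_measure (dirac_comb I a x)) A = emeasure (dirac_comb I (\<lambda>i. a i * x i) x) A"
    using assms
    by (simp add: t_measure_def emeasure_density nn emeasure_dirac_comb ennreal_mult' mult.assoc)
qed (simp add: t_measure_def)

end

theory Submission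
  imports Defs
begin

text \<open>A root \<open>\<nu>\<close> of a finitely supported measure on \<open>(0, \<infinity>)\<close> is finitely supported, because for some
  \<open>y\<close> almost every \<open>x\<close> satisfies \<open>x y \<in> supp (\<nu> * \<nu>)\<close>. For \<open>\<mu> * t\<mu>\<close>, comparing extreme products shows
  that the support of the root lies among the six \<open>\<lambda>\<^sub>i\<close>; let \<open>B\<^sub>i\<close> be its weights. Then for every
  \<open>z\<close> the numbers \<open>F\<^sub>i\<^sub>j = B\<^sub>i B\<^sub>j - a\<^sub>i a\<^sub>j (\<lambda>\<^sub>i + \<lambda>\<^sub>j) / 2\<close> with \<open>\<lambda>\<^sub>i \<lambda>\<^sub>j = z\<close> add up to \<open>0\<close>. Products that
  are attained only once determine most \<open>B\<^sub>i\<close>; then \<open>F\<^sub>1\<^sub>5, F\<^sub>2\<^sub>5 < 0\<close> must be cancelled by other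
  pairs, which forces \<open>\<lambda>\<^sub>3\<^sup>2 = \<lambda>\<^sub>1 \<lambda>\<^sub>6\<close>, and the relations between the \<open>a\<^sub>i\<close> follow. Conversely the
  root of \<open>\<mu>\<close> has atoms \<open>\<surd>\<lambda>\<^sub>1, \<surd>\<lambda>\<^sub>4, \<surd>\<lambda>\<^sub>6\<close>, and \<open>\<nu> * t\<nu>\<close> is a root of \<open>\<mu> * t\<mu>\<close> if \<open>\<nu>\<close> is one of \<open>\<mu>\<close>.
  The second case is the first one for the inverses \<open>1 / \<lambda>\<^sub>i\<close>.\<close>

section \<open>Convolution roots of finitely supported measures\<close>

text \<open>A comb is the image of a weighted counting measure; integration against it thereby
  reduces to a finite sum.\<close>

lemma dirac_comb_eq_distr:
  assumes "finite I"
  shows "dirac_comb I a x = distr (density (count_space I) (\<lambda>i. ennreal (a i))) borel x"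
proof (rule measure_eqI)
  fix A assume "A \<in> sets (dirac_comb I a x)"
  then have A: "A \<in> sets borel" by simp
  have "emeasure (distr (density (count_space I) (\<lambda>i. ennreal (a i))) borel x) A =
      (\<Sum>i\<in>I. ennreal (a i) * indicator (x -` A \<inter> I) i)"
    using A assms by (simp add: emeasure_distr emeasure_density nn_integral_count_space_finite)
  also have "\<dots> = emeasure (dirac_comb I a x) A"
    using A by (auto simp: emeasure_dirac_comb indicator_def intro!: sum.cong)
  finally show "emeasure (dirac_comb I a x) A =
      emeasure (distr (density (count_space I) (\<lambda>i. ennreal (a i))) borel x) A" ..
qed simp

lemma nn_integral_dirac_comb:
  assumes "finite I" and [measurable]: "f \<in> borel_measurable borel"
  shows "(\<integral>\<^sup>+t. f t \<partial>dirac_comb I a x) = (\<Sum>i\<in>I. ennreal (a i) * f (x i))"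
  using assms(1)
  by (simp add: dirac_comb_eq_distr nn_integral_distr nn_integral_density
      nn_integral_count_space_finite)

lemma space_dirac_comb [simp]: "space (dirac_comb I a x) = UNIV"
  using sets_eq_imp_space_eq[OF sets_dirac_comb] by simp

lemma finite_measure_dirac_comb:
  assumes "finite I"
  shows "finite_measure (dirac_comb I a x)"
  by (rule finite_measureI) (simp add: emeasure_dirac_comb assms)

lemma mult_convolution_dirac_comb:
  assumes "finite I" "finite J" "\<And>i. i \<in> I \<Longrightarrow> 0 \<le> a i"
  shows "mult_convolution (dirac_comb I a x) (dirac_comb J b y) =
    dirac_comb (I \<times> J) (\<lambda>(i, j). a i * b j) (\<lambda>(i, j). x i * y j)"
proof (rule measure_eqI)
  fix A assume "A \<in> sets (mult_convolution (dirac_comb I a x) (dirac_comb J b y))"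
  then have A [measurable]: "A \<in> sets borel" by (simp add: mult_convolution_def)
  have "emeasure (mult_convolution (dirac_comb I a x) (dirac_comb J b y)) A =
      (\<Sum>j\<in>J. \<Sum>i\<in>I. ennreal (b j) * (ennreal (a i) * indicator A (x i * y j)))"
    using assms
    by (subst emeasure_mult_convolution)
       (simp_all add: finite_measure_dirac_comb finite_measure.axioms(1) nn_integral_dirac_comb sum_distrib_left
         del: sum_mult_indicator sum_indicator_mult)
  also have "\<dots> = (\<Sum>i\<in>I. \<Sum>j\<in>J. ennreal (a i * b j) * indicator A (x i * y j))"
    using assms by (subst sum.swap) (simp add: ennreal_mult' mult_ac)
  also have "\<dots> = emeasure (dirac_comb (I \<times> J) (\<lambda>(i, j). a i * b j) (\<lambda>(i, j). x i * y j)) A"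
    by (simp add: emeasure_dirac_comb sum.cartesian_product case_prod_beta)
  finally show "emeasure (mult_convolution (dirac_comb I a x) (dirac_comb J b y)) A =
    emeasure (dirac_comb (I \<times> J) (\<lambda>(i, j). a i * b j) (\<lambda>(i, j). x i * y j)) A" .
qed (simp add: mult_convolution_def)

lemma dirac_comb_reindex:
  assumes "bij_betw h I J" "\<And>i. i \<in> I \<Longrightarrow> a i = b (h i)" "\<And>i. i \<in> I \<Longrightarrow> x i = y (h i)"
  shows "dirac_comb I a x = dirac_comb J b y"
proof (rule measure_eqI)
  fix A assume "A \<in> sets (dirac_comb I a x)"
  then show "emeasure (dirac_comb I a x) A = emeasure (dirac_comb J b y) A"
    using assms(2,3)
    by (simp add: emeasure_dirac_comb sum.reindex_bij_betw[OF assms(1), symmetric])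
qed simp

text \<open>Since \<open>x\<close> need not be injective, indices over the same point pool their
  weights. Reading off these masses turns an equality of measures into equations between real
  numbers.\<close>

lemma measure_dirac_comb_singleton:
  assumes "finite I" "\<And>i. i \<in> I \<Longrightarrow> 0 \<le> a i"
  shows "measure (dirac_comb I a x) {z} = (\<Sum>i | i \<in> I \<and> x i = z. a i)"
proof -
  have "emeasure (dirac_comb I a x) {z} = (\<Sum>i\<in>I. ennreal (if x i = z then a i else 0))"
    by (auto simp: emeasure_dirac_comb indicator_def intro!: sum.cong)
  also have "\<dots> = ennreal (\<Sum>i | i \<in> I \<and> x i = z. a i)"
    using assms by (simp add: sum.inter_filter)
  finally show ?thesis
    using assms by (auto simp: measure_def intro!: enn2real_ennreal sum_nonneg)
qed

text \<open>No \<open>\<sigma>\<close>-finiteness is available here; if the double integral fails to be a measure, the product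
  measure is \<open>0\<close> by convention, which the second assumption excludes.\<close>

lemma emeasure_mult_convolution_UNIV:
  assumes N: "sets N = sets borel" and nz: "emeasure (mult_convolution N N) UNIV \<noteq> 0"
  shows "emeasure (mult_convolution N N) UNIV = emeasure N UNIV * emeasure N UNIV"
proof -
  note [measurable_cong] = N
  have sp: "space N = UNIV" using sets_eq_imp_space_eq[OF N] by simp
  have *: "emeasure (mult_convolution N N) UNIV = emeasure (N \<Otimes>\<^sub>M N) UNIV"
    unfolding mult_convolution_def by (subst emeasure_distr) (simp_all add: space_pair_measure sp)
  also have "\<dots> = (\<integral>\<^sup>+x. \<integral>\<^sup>+y. indicator UNIV (x, y) \<partial>N \<partial>N)"
    using nz unfolding * unfolding pair_measure_def
    by (subst (asm) emeasure_measure_of_conv, subst emeasure_measure_of_conv) (auto split: if_splits)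
  finally show ?thesis by (simp add: sp[symmetric])
qed

section \<open>Structure of an arbitrary root\<close>

lemma concentrated_eq_dirac_comb:
  assumes N: "sets N = sets borel" "emeasure N UNIV < \<infinity>"
    and T: "finite T" "emeasure N (- T) = 0"
  shows "N = dirac_comb T (\<lambda>t. measure N {t}) (\<lambda>t. t)"
proof (rule measure_eqI)
  have sp: "space N = UNIV" using sets_eq_imp_space_eq[OF N(1)] by simp
  interpret finite_measure N
    by (rule finite_measureI) (use N(2) sp in simp)
  fix A assume A': "A \<in> sets N"
  then have A: "A \<in> sets borel" using N by simp
  have "emeasure N A = emeasure N (A \<inter> T)"
  proof (rule emeasure_eq_AE)
    have "- T \<in> null_sets N"
      using T N by (auto simp: null_sets_def finite_imp_closed)
    then have "AE t in N. t \<in> T" by (rule AE_I') auto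
    then show "AE t in N. t \<in> A \<longleftrightarrow> t \<in> A \<inter> T" by eventually_elim simp
  qed (use A' T N A in \<open>auto intro!: sets.Int simp: finite_imp_closed\<close>)
  also have "\<dots> = (\<Sum>t\<in>A \<inter> T. emeasure N {t})"
    using T N by (intro emeasure_eq_sum_singleton) auto
  also have "\<dots> = (\<Sum>t\<in>T. if t \<in> A then emeasure N {t} else 0)"
    using T by (simp add: sum.inter_restrict[symmetric] Int_commute)
  also have "\<dots> = emeasure (dirac_comb T (\<lambda>t. measure N {t}) (\<lambda>t. t)) A"
    using A by (auto simp: emeasure_dirac_comb emeasure_eq_measure indicator_def intro!: sum.cong)
  finally show "emeasure N A = emeasure (dirac_comb T (\<lambda>t. measure N {t}) (\<lambda>t. t)) A" .
qed (simp add: N)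

text \<open>The squared total mass of the root is finite and nonzero, so the root \<open>N\<close>
  is a nonzero finite measure and the double integral formula applies. For almost every
  \<open>y\<close> it makes \<open>x * y\<close> lie in the finite set \<open>S\<close> for almost
  every \<open>x\<close>; one such \<open>y = z\<close> confines \<open>N\<close> to the finite set
  \<open>Y\<close> of quotients.\<close>

lemma square_root_dirac_combE:
  assumes root: "has_square_root (dirac_comb K c y)"
    and K: "finite K" "K \<noteq> {}" "\<And>k. k \<in> K \<Longrightarrow> 0 < c k" "\<And>k. k \<in> K \<Longrightarrow> 0 < y k"
  obtains T b where "finite T" "T \<subseteq> {0<..}" "\<And>t. t \<in> T \<Longrightarrow> 0 < b t"
    "mult_convolution (dirac_comb T b (\<lambda>t. t)) (dirac_comb T b (\<lambda>t. t)) = dirac_comb K c y"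
proof -
  define E where "E = dirac_comb K c y"
  obtain N where N: "sets N = sets borel" "emeasure N {..<0} = 0" "mult_convolution N N = E"
    using root unfolding has_square_root_def E_def by auto
  note [measurable_cong] = N(1)
  have sp: "space N = UNIV" using sets_eq_imp_space_eq[OF N(1)] by simp
  have EU: "emeasure E UNIV = (\<Sum>k\<in>K. ennreal (c k))"
    by (simp add: E_def emeasure_dirac_comb)
  then have E0: "emeasure E UNIV \<noteq> 0" and Efin: "emeasure E UNIV \<noteq> \<infinity>"
    using K by (auto simp: ennreal_sum_eq_top) (metis ennreal_eq_0_iff not_le ex_in_conv)
  have "emeasure E UNIV = emeasure N UNIV * emeasure N UNIV"
    using emeasure_mult_convolution_UNIV[OF N(1)] N(3) E0 by simp
  then have N0: "emeasure N UNIV \<noteq> 0" and Nfin: "emeasure N UNIV < \<infinity>"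
    using E0 Efin by (auto simp: ennreal_mult_eq_top_iff less_top)
  interpret finite_measure N
    by (rule finite_measureI) (use Nfin sp in simp)
  define S where "S = y ` K"
  have S: "finite S" "0 \<notin> S" using K by (force simp: S_def)+
  then have [measurable]: "S \<in> sets borel" by (simp add: finite_imp_closed)
  have "emeasure E (- S) = 0"
    using K by (auto simp: E_def S_def emeasure_dirac_comb finite_imp_closed)
  moreover have "emeasure E (- S) = (\<integral>\<^sup>+y. \<integral>\<^sup>+x. indicator (- S) (x * y) \<partial>N \<partial>N)"
    unfolding N(3)[symmetric] by (intro emeasure_mult_convolution) (auto simp: N sigma_finite_measure_axioms)
  ultimately have "AE y in N. (\<integral>\<^sup>+x. indicator (- S) (x * y) \<partial>N) = 0"
    by (subst nn_integral_0_iff_AE[symmetric]) auto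
  moreover have "ae_filter N \<noteq> bot"
    using N0 by (simp add: ae_filter_eq_bot_iff sp)
  ultimately obtain z where z: "(\<integral>\<^sup>+x. indicator (- S) (x * z) \<partial>N) = 0"
    using eventually_happens by blast
  define Y where "Y = {x. x * z \<in> S}"
  \<comment> \<open>For \<open>z = 0\<close> all products are \<open>0\<close>, which is outside
    \<open>S\<close>, and the vanishing integral would be the whole mass of
    \<open>N\<close>.\<close>
  have "z \<noteq> 0" using z S N0 by (auto simp: sp)
  then have "Y = (\<lambda>s. s / z) ` S"
    by (force simp: Y_def)
  then have Y: "finite Y" "0 \<notin> Y" using S by (auto simp: Y_def)
  have "emeasure N (- Y) = (\<integral>\<^sup>+x. indicator (- Y) x \<partial>N)"
    using Y N by (simp add: finite_imp_closed)
  also have "\<dots> = (\<integral>\<^sup>+x. indicator (- S) (x * z) \<partial>N)"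
    by (intro nn_integral_cong) (auto simp: Y_def indicator_def)
  finally have NY: "emeasure N (- Y) = 0" using z by simp
  define T where "T = {t\<in>Y. 0 < t \<and> 0 < measure N {t}}"
  have T: "finite T" using Y by (simp add: T_def)
  \<comment> \<open>Because \<open>0\<close> is not in \<open>Y\<close>, a nonpositive point of
    \<open>Y\<close> is negative, where \<open>N\<close> has no mass.\<close>
  have "emeasure N (- T) \<le> emeasure N (- Y \<union> {..<0} \<union> {t\<in>Y. measure N {t} = 0})"
    using Y N by (intro emeasure_mono) (auto simp: T_def finite_imp_closed less_le not_less)
  also have "\<dots> \<le> emeasure N (- Y) + emeasure N {..<0} + emeasure N {t\<in>Y. measure N {t} = 0}"
    using Y N by (intro order_trans[OF emeasure_subadditive] add_right_mono)
      (auto simp: finite_imp_closed)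
  also have "emeasure N {t\<in>Y. measure N {t} = 0} = 0"
    using Y N by (subst emeasure_eq_sum_singleton) (auto simp: emeasure_eq_measure)
  finally have NT: "emeasure N (- T) = 0" using NY N by simp
  have eq: "dirac_comb T (\<lambda>t. measure N {t}) (\<lambda>t. t) = N"
    by (rule concentrated_eq_dirac_comb[OF N(1) Nfin T NT, symmetric])
  show ?thesis
  proof (rule that)
    show "mult_convolution (dirac_comb T (\<lambda>t. measure N {t}) (\<lambda>t. t))
        (dirac_comb T (\<lambda>t. measure N {t}) (\<lambda>t. t)) = dirac_comb K c y"
      unfolding eq using N(3) by (simp only: E_def)
  qed (auto simp: T_def Y(1))
qed

section \<open>Construction of roots\<close>

lemma has_square_root_dirac_combI:
  assumes "finite T" "\<And>t. t \<in> T \<Longrightarrow> 0 \<le> b t" "\<And>t. t \<in> T \<Longrightarrow> 0 \<le> x t"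
    "mult_convolution (dirac_comb T b x) (dirac_comb T b x) = E"
  shows "has_square_root E"
  unfolding has_square_root_def
proof (intro exI conjI)
  have "return borel (x t) {..<0} = 0" if "t \<in> T" for t
    using assms(3)[OF that] by simp
  then show "emeasure (dirac_comb T b x) {..<0} = 0"
    using assms(1,3) by (simp add: emeasure_dirac_comb)
qed (use assms in auto)

text \<open>Weighting by \<open>t\<close> is multiplicative: if
  \<open>\<mu> = \<nu> * \<nu>\<close>, then \<open>t\<mu> = t\<nu> * t\<nu>\<close>, and
  \<open>\<mu> * t\<mu>\<close> regroups as the square of \<open>\<nu> * t\<nu>\<close>.\<close>

lemma has_square_root_convolution_t_measure:
  assumes root: "has_square_root (dirac_comb K c y)"
    and K: "finite K" "K \<noteq> {}" "\<And>k. k \<in> K \<Longrightarrow> 0 < c k" "\<And>k. k \<in> K \<Longrightarrow> 0 < y k"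
  shows "has_square_root (mult_convolution (dirac_comb K c y) (t_measure (dirac_comb K c y)))"
proof -
  obtain T b where T: "finite T" "T \<subseteq> {0<..}" "\<And>t. t \<in> T \<Longrightarrow> 0 < b t"
    and conv: "mult_convolution (dirac_comb T b (\<lambda>t. t)) (dirac_comb T b (\<lambda>t. t)) = dirac_comb K c y"
    using square_root_dirac_combE[OF assms] by metis
  have nn: "0 \<le> b t" "0 \<le> t" if "t \<in> T" for t
    using T that by (auto simp: less_imp_le subset_eq)
  have eq: "dirac_comb K c y = dirac_comb (T \<times> T) (\<lambda>(s, t). b s * b t) (\<lambda>(s, t). s * t)"
    using T nn by (simp flip: conv add: mult_convolution_dirac_comb)
  \<comment> \<open>\<open>?d\<close> holds the weights of \<open>\<nu> * t\<nu>\<close> and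
    \<open>?c\<close> those of \<open>\<nu> * \<nu>\<close>. The regrouping is the involution
    \<open>?h\<close>, which swaps the two middle indices.\<close>
  let ?m = "\<lambda>(s, t). s * t :: real" and ?c = "\<lambda>(s, t). b s * b t" and ?d = "\<lambda>(s, t). b s * (b t * t)"
  let ?h = "\<lambda>((s, t), (s', t')). ((s, s'), (t, t'))"
  have t: "t_measure (dirac_comb K c y) = dirac_comb (T \<times> T) (\<lambda>i. ?c i * ?m i) ?m"
    unfolding eq by (rule t_measure_dirac_comb) (auto simp: nn)
  show ?thesis
  proof (rule has_square_root_dirac_combI)
    have "mult_convolution (dirac_comb (T \<times> T) ?d ?m) (dirac_comb (T \<times> T) ?d ?m) =
      dirac_comb ((T \<times> T) \<times> T \<times> T) (\<lambda>(i, j). ?d i * ?d j) (\<lambda>(i, j). ?m i * ?m j)"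
      by (rule mult_convolution_dirac_comb) (use T(1) nn in auto)
    also have "\<dots> = dirac_comb ((T \<times> T) \<times> T \<times> T) (\<lambda>(i, j). ?c i * (?c j * ?m j)) (\<lambda>(i, j). ?m i * ?m j)"
    proof (rule dirac_comb_reindex[where h = ?h])
      show "bij_betw ?h ((T \<times> T) \<times> T \<times> T) ((T \<times> T) \<times> T \<times> T)"
        by (rule bij_betw_byWitness[where f' = ?h]) auto
    qed (auto simp: mult_ac)
    also have "\<dots> = mult_convolution (dirac_comb K c y) (t_measure (dirac_comb K c y))"
      unfolding t unfolding eq
      by (rule mult_convolution_dirac_comb[symmetric]) (use T(1) nn in auto)
    finally show "mult_convolution (dirac_comb (T \<times> T) ?d ?m) (dirac_comb (T \<times> T) ?d ?m) =
      mult_convolution (dirac_comb K c y) (t_measure (dirac_comb K c y))" .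
  qed (use T(1) nn in auto)
qed

text \<open>Squaring three atoms at \<open>sqrt (l i)\<close>, \<open>sqrt (l j)\<close>,
  \<open>sqrt (l k)\<close> gives the three squares and three mixed products. Each mixed product
  arises from two ordered pairs, whence the factor \<open>4\<close> in the relations for squared
  weights.\<close>

lemma has_square_root_three_atoms:
  assumes d: "distinct [i, j, k, m, n, p]"
    and a: "\<And>t. t \<in> {i, j, k, m, n, p} \<Longrightarrow> 0 \<le> a t"
    and l: "\<And>t. t \<in> {i, j, k, m, n, p} \<Longrightarrow> 0 \<le> l t"
    and lm: "(l m)\<^sup>2 = l i * l j" "(a m)\<^sup>2 = 4 * a i * a j"
    and ln: "(l n)\<^sup>2 = l j * l k" "(a n)\<^sup>2 = 4 * a j * a k"
    and lp: "(l p)\<^sup>2 = l i * l k" "(a p)\<^sup>2 = 4 * a i * a k"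
  shows "has_square_root (dirac_comb {i, j, k, m, n, p} a l)"
proof (rule has_square_root_dirac_combI)
  let ?N = "dirac_comb {i, j, k} (\<lambda>t. sqrt (a t)) (\<lambda>t. sqrt (l t))"
  show "mult_convolution ?N ?N = dirac_comb {i, j, k, m, n, p} a l"
  proof (rule measure_eqI)
    fix A assume "A \<in> sets (mult_convolution ?N ?N)"
    then have A: "A \<in> sets borel" by (simp add: mult_convolution_def)
    define f where "f t = ennreal (a t) * indicator A (l t)" for t
    \<comment> \<open>Half of \<open>f t\<close>: the share of one ordered pair in a mixed
      atom.\<close>
    define g where "g t = ennreal (a t / 2) * indicator A (l t)" for t
    define h where "h s t = ennreal (sqrt (a s) * sqrt (a t)) * indicator A (sqrt (l s) * sqrt (l t))" for s t
    have h1: "h t t = f t" if "t \<in> {i, j, k, m, n, p}" for t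
      using a[OF that] l[OF that] by (simp add: h_def f_def)
    have f: "f t = g t + g t" if "t \<in> {i, j, k, m, n, p}" for t
      using a[OF that] by (simp add: f_def g_def flip: distrib_right ennreal_plus)
    have h2: "h r s = g t" "h s r = g t"
      if "(l t)\<^sup>2 = l r * l s" "(a t)\<^sup>2 = 4 * a r * a s" "0 \<le> a t" "0 \<le> l t" for r s t
    proof -
      have "sqrt (l r) * sqrt (l s) = l t"
        unfolding real_sqrt_mult[symmetric] that(1)[symmetric] using that(4) by simp
      moreover have "sqrt (a r) * sqrt (a s) = sqrt ((a t / 2)\<^sup>2)"
        unfolding real_sqrt_mult[symmetric] power_divide that(2) by simp
      then have "sqrt (a r) * sqrt (a s) = a t / 2"
        using that(3) by (simp only: real_sqrt_abs)
      ultimately show "h r s = g t" "h s r = g t"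
        by (simp_all only: h_def g_def mult.commute[of "sqrt (l s)"] mult.commute[of "sqrt (a s)"])
    qed
    have f': "f m = g m + g m" "f n = g n + g n" "f p = g p + g p"
      by (rule f; simp)+
    have hh: "h i i = f i" "h j j = f j" "h k k = f k"
        "h i j = g m" "h j i = g m" "h j k = g n" "h k j = g n" "h i k = g p" "h k i = g p"
      by (rule h1 h2[OF lm] h2[OF ln] h2[OF lp]; simp add: a l)+
    have ne: "i \<notin> {j, k}" "j \<notin> {k}" "i \<notin> {j, k, m, n, p}" "j \<notin> {k, m, n, p}"
        "k \<notin> {m, n, p}" "m \<notin> {n, p}" "n \<notin> {p}"
      using d by auto
    have "emeasure (mult_convolution ?N ?N) A = (\<Sum>s\<in>{i, j, k}. \<Sum>t\<in>{i, j, k}. h s t)"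
      using a A by (subst mult_convolution_dirac_comb)
        (auto simp: emeasure_dirac_comb sum.cartesian_product case_prod_beta h_def
          simp del: sum_mult_indicator sum_indicator_mult)
    also have "\<dots> = (\<Sum>t\<in>{i, j, k, m, n, p}. f t)"
      using ne by (simp only: sum.insert sum.empty finite.intros not_False_eq_True hh f' add_ac empty_iff add_0_left add_0_right)
    also have "\<dots> = emeasure (dirac_comb {i, j, k, m, n, p} a l) A"
      unfolding emeasure_dirac_comb[OF A] emeasure_return[OF A] f_def ..
    finally show "emeasure (mult_convolution ?N ?N) A = emeasure (dirac_comb {i, j, k, m, n, p} a l) A" .
  qed (simp add: mult_convolution_def)
qed (use a l in auto)

section \<open>Rigidity of the coefficients\<close>

text \<open>Comparing extreme squares puts \<open>T\<close> between \<open>l 1\<close> and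
  \<open>l 6\<close> and makes both endpoints members. If \<open>t < l 4\<close>, then
  \<open>l 1 * t\<close> is below \<open>l 1 * l 4\<close>, the square of \<open>l 2\<close>, so a
  factorization of it as \<open>l i * l j\<close> must use the index 1, which cancels. Above
  \<open>l 4\<close> the same works with \<open>l 6\<close> and \<open>l 5\<close>.\<close>

lemma square_support_subset:
  fixes l :: "nat \<Rightarrow> real"
  assumes T: "finite T" "T \<subseteq> {0<..}"
    and l: "0 < l 1" "strict_mono_on {1..6} l"
    and rel: "(l 2)\<^sup>2 = l 1 * l 4" "(l 5)\<^sup>2 = l 4 * l 6"
    and eq: "(\<lambda>(s, t). s * t) ` (T \<times> T) = (\<lambda>(i, j). l i * l j) ` ({1..6} \<times> {1..6})"
  shows "T \<subseteq> l ` {1..6}" "l 1 \<in> T" "l 6 \<in> T"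
proof -
  have mono: "l i \<le> l j" if "i \<in> {1..6}" "j \<in> {1..6}" "i \<le> j" for i j
    using strict_mono_on_leD[OF l(2)] that by blast
  have pos: "0 < l i" if "i \<in> {1..6}" for i
    using mono[of 1 i] that l(1) by auto
  have Tpos: "0 < t" if "t \<in> T" for t using T that by auto
  have prodE: "\<exists>i\<in>{1..6}. \<exists>j\<in>{1..6}. s * t = l i * l j" if "s \<in> T" "t \<in> T" for s t
  proof -
    have "s * t \<in> (\<lambda>(s, t). s * t) ` (T \<times> T)" using that by force
    then show ?thesis unfolding eq by auto
  qed
  have sqE: "\<exists>s\<in>T. \<exists>t\<in>T. l i * l i = s * t" if "i \<in> {1..6}" for i
  proof -
    have "l i * l i \<in> (\<lambda>(i, j). l i * l j) ` ({1..6} \<times> {1..6})" using that by force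
    then show ?thesis unfolding eq[symmetric] by auto
  qed
  have lo: "l 1 \<le> t" if "t \<in> T" for t
  proof -
    obtain i j where ij: "i \<in> {1..6}" "j \<in> {1..6}" "t * t = l i * l j"
      using prodE[OF \<open>t \<in> T\<close> \<open>t \<in> T\<close>] by auto
    have "l 1 * l 1 \<le> l i * l j"
      using ij mono[of 1 i] mono[of 1 j] l(1) by (intro mult_mono) auto
    then show ?thesis
      using ij(3) Tpos[OF that] l(1) by (metis abs_le_square_iff abs_of_pos power2_eq_square)
  qed
  have hi: "t \<le> l 6" if "t \<in> T" for t
  proof -
    obtain i j where ij: "i \<in> {1..6}" "j \<in> {1..6}" "t * t = l i * l j"
      using prodE[OF \<open>t \<in> T\<close> \<open>t \<in> T\<close>] by auto
    have "l i * l j \<le> l 6 * l 6"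
      using ij mono[of i 6] mono[of j 6] pos[of i] pos[of j] pos[of 6] by (intro mult_mono) auto
    then show ?thesis
      using ij(3) Tpos[OF that] pos[of 6]
      by (metis abs_le_square_iff abs_of_pos atLeastAtMost_iff numeral_le_iff one_le_numeral order_refl power2_eq_square)
  qed
  show l1: "l 1 \<in> T"
  proof -
    obtain s t where st: "s \<in> T" "t \<in> T" "l 1 * l 1 = s * t" using sqE[of 1] by auto
    have "s = l 1"
      using lo[OF st(1)] lo[OF st(2)] st(3) l(1) mult_strict_mono'[of "l 1" s "l 1" t]
        mult_less_le_imp_less[of "l 1" s "l 1" t] by fastforce
    then show ?thesis using st by simp
  qed
  show l6: "l 6 \<in> T"
  proof -
    obtain s t where st: "s \<in> T" "t \<in> T" "l 6 * l 6 = s * t" using sqE[of 6] by auto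
    have "s = l 6"
      using hi[OF st(1)] hi[OF st(2)] st(3) Tpos[OF st(1)] Tpos[OF st(2)]
        mult_less_le_imp_less[of s "l 6" t "l 6"] by fastforce
    then show ?thesis using st by simp
  qed
  show "T \<subseteq> l ` {1..6}"
  proof
    fix t assume t: "t \<in> T"
    consider "t < l 4" | "t = l 4" | "l 4 < t" by linarith
    then show "t \<in> l ` {1..6}"
    proof cases
      case 1
      obtain i j where ij: "i \<in> {1..6}" "j \<in> {1..6}" "l 1 * t = l i * l j"
        using prodE[OF l1 t] by auto
      have "i = 1 \<or> j = 1"
      proof (rule ccontr)
        assume "\<not> ?thesis"
        then have "l 2 * l 2 \<le> l i * l j"
          using ij mono[of 2 i] mono[of 2 j] pos[of 2] by (intro mult_mono) auto
        then have "l 1 * l 4 \<le> l 1 * t" using ij rel by (simp add: power2_eq_square)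
        then show False using 1 l(1) by simp
      qed
      then have "t = l i \<or> t = l j" using ij l(1) by auto
      then show ?thesis using ij by auto
    next
      case 3
      obtain i j where ij: "i \<in> {1..6}" "j \<in> {1..6}" "l 6 * t = l i * l j"
        using prodE[OF l6 t] by auto
      have "i = 6 \<or> j = 6"
      proof (rule ccontr)
        assume "\<not> ?thesis"
        then have "l i * l j \<le> l 5 * l 5"
          using ij mono[of i 5] mono[of j 5] pos[of i] pos[of j] by (intro mult_mono) auto
        then have "l 6 * t \<le> l 6 * l 4" using ij rel by (simp add: power2_eq_square mult.commute)
        then show False using 3 pos[of 6] by simp
      qed
      then have "t = l i \<or> t = l j" using ij pos[of 6] by auto
      then show ?thesis using ij by auto
    qed auto
  qed
qed

text \<open>Pairs whose \<open>F\<close> is known to vanish may be left out, so each balance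
  equation can be written for a short explicit list \<open>Q\<close>.\<close>

lemma sum_pairs_eq_0:
  fixes F :: "nat \<Rightarrow> nat \<Rightarrow> real"
  assumes bal: "\<And>z. (\<Sum>(i, j) | (i, j) \<in> I \<times> I \<and> l i * l j = z. F i j) = 0"
    and "finite I" "Q \<subseteq> I \<times> I" "\<And>i j. (i, j) \<in> Q \<Longrightarrow> l i * l j = (z :: real)"
    and "\<And>i j. i \<in> I \<Longrightarrow> j \<in> I \<Longrightarrow> l i * l j = z \<Longrightarrow> (i, j) \<notin> Q \<Longrightarrow> F i j = 0"
  shows "(\<Sum>(i, j)\<in>Q. F i j) = 0"
proof -
  have "finite {(i, j). (i, j) \<in> I \<times> I \<and> l i * l j = z}"
    by (rule finite_subset[of _ "I \<times> I"]) (use assms(2) in auto)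
  then have "(\<Sum>(i, j)\<in>Q. F i j) = (\<Sum>(i, j) | (i, j) \<in> I \<times> I \<and> l i * l j = z. F i j)"
    using assms(3-5) by (intro sum.mono_neutral_left) (auto simp: case_prod_beta)
  then show ?thesis using bal by simp
qed

lemma balanced_products_rigid:
  fixes a l B :: "nat \<Rightarrow> real"
  assumes a: "\<And>i. i \<in> {1..6} \<Longrightarrow> 0 < a i"
    and l: "0 < l 1" "strict_mono_on {1..6} l"
    and rel: "(l 2)\<^sup>2 = l 1 * l 4" "(l 5)\<^sup>2 = l 4 * l 6"
    and B: "0 \<le> B 1" "0 \<le> B 6"
    and bal: "\<And>z. (\<Sum>(i, j) | (i, j) \<in> {1..6} \<times> {1..6} \<and> l i * l j = z.
        B i * B j - a i * a j * (l i + l j) / 2) = 0"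
  shows "(l 3)\<^sup>2 = l 1 * l 6" "(a 2)\<^sup>2 = 4 * a 1 * a 4" "(a 3)\<^sup>2 = 4 * a 1 * a 6"
    "(a 5)\<^sup>2 = 4 * a 4 * a 6"
proof -
  have I: "{1..6} = {1, 2, 3, 4, 5, 6 :: nat}" by auto
  have less: "l 1 < l 2" "l 2 < l 3" "l 3 < l 4" "l 4 < l 5" "l 5 < l 6"
    by (rule strict_mono_onD[OF l(2)]; simp)+
  have ap: "0 < a 1" "0 < a 2" "0 < a 3" "0 < a 4" "0 < a 5" "0 < a 6"
    using a by auto
  \<comment> \<open>All \<open>l i\<close> are monomials in \<open>u, w, v\<close> except \<open>s\<close>; on the logarithmic scale, starting from \<open>ln (l 1)\<close>, the
    points are \<open>0, p, r, 2p, 2p + q, 2p + 2q\<close>, and the goal for \<open>l 3\<close> is \<open>r = p + q\<close>.\<close>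
  define u w v s where "u = sqrt (l 1)" and "w = sqrt (l 4)" and "v = sqrt (l 6)" and "s = l 3"
  have ord: "0 < u" "u < w" "w < v" "0 < s"
    using l less by (auto simp: u_def w_def v_def s_def)
  have l1: "l 1 = u\<^sup>2" and l4: "l 4 = w\<^sup>2" and l6: "l 6 = v\<^sup>2"
    using l less by (auto simp: u_def w_def v_def)
  have "0 < l 2" "0 < l 5"
    using l(1) less by linarith+
  have l2: "l 2 = u * w"
    using rel(1) ord \<open>0 < l 2\<close> unfolding l1 l4
    by (intro power2_eq_imp_eq[of "l 2"]) (auto simp: power_mult_distrib)
  have l5: "l 5 = v * w"
    using rel(2) ord \<open>0 < l 5\<close> unfolding l6 l4
    by (intro power2_eq_imp_eq[of "l 5"]) (auto simp: power_mult_distrib)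
  define X where "X i = ln (l i)" for i
  define p q r where "p = X 2 - X 1" and "q = X 6 - X 5" and "r = X 3 - X 1"
  have pos: "0 < l i" if "i \<in> {1..6}" for i
    using strict_mono_on_leD[OF l(2), of 1 i] that l(1) by auto
  have X: "X 2 = X 1 + p" "X 3 = X 1 + r" "X 4 = X 1 + 2 * p"
      "X 5 = X 1 + 2 * p + q" "X 6 = X 1 + 2 * p + 2 * q"
    using ord unfolding p_def q_def r_def X_def l1 l2 l4 l5 l6
    by (simp_all add: ln_mult ln_realpow)
  have "X 1 < X 2" "X 2 < X 3" "X 3 < X 4" "X 5 < X 6"
    unfolding X_def using l less by auto
  then have pqr: "0 < p" "p < r" "r < 2 * p" "0 < q" by (simp_all add: X)

  define F where "F i j = B i * B j - a i * a j * (l i + l j) / 2" for i j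
  have F_commute: "F i j = F j i" for i j by (simp del: One_nat_def add: F_def algebra_simps)
  \<comment> \<open>On the logarithmic scale, coincidences of products are linear equations in
    \<open>p\<close>, \<open>q\<close>, \<open>r\<close>, which linear arithmetic decides pair by
    pair. By symmetry of \<open>F\<close> only pairs with \<open>i \<le> j\<close> are
    inspected.\<close>
  have balance: "(\<Sum>(i, j)\<in>Q. F i j) = 0"
    if "Q \<subseteq> {1..6} \<times> {1..6}" "\<forall>(i, j)\<in>Q. X i + X j = z"
      "\<forall>i\<in>{1..6}. \<forall>j\<in>{1..6}. i \<le> j \<longrightarrow> X i + X j = z \<longrightarrow> ((i, j) \<in> Q \<and> (j, i) \<in> Q) \<or> F i j = 0" for Q z
  proof (rule sum_pairs_eq_0[where l = l and z = "exp z" and I = "{1..6}"])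
    have *: "l i * l j = exp z \<longleftrightarrow> X i + X j = z" if "i \<in> {1..6}" "j \<in> {1..6}" for i j
      using pos[OF that(1)] pos[OF that(2)]
      by (metis X_def exp_ln ln_exp ln_mult_pos mult_pos_pos)
    show "l i * l j = exp z" if "(i, j) \<in> Q" for i j
      using that \<open>Q \<subseteq> _\<close> \<open>\<forall>(i, j)\<in>Q. _\<close> * by blast
    show "F i j = 0" if "i \<in> {1..6}" "j \<in> {1..6}" "l i * l j = exp z" "(i, j) \<notin> Q" for i j
      using that(1,2,4) \<open>\<forall>i\<in>{1..6}. _\<close> *[OF that(1,2)] that(3) F_commute[of i j]
      by (metis add.commute nle_le)
  qed (use bal that(1) in \<open>simp_all add: F_def\<close>)
  \<comment> \<open>The products 11, 12, 13 at the lower end and 66, 56 at the upper end are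
    attained by one unordered pair each.\<close>
  have "(\<Sum>(i, j)\<in>{(1, 1)}. F i j) = 0"
    by (rule balance[of _ "X 1 + X 1"], simp, simp add: X, unfold I, intro ballI impI)
      (elim insertE emptyE; simp del: One_nat_def add: X; use pqr in linarith)
  then have "F 1 1 = 0"
    by simp
  have "(\<Sum>(i, j)\<in>{(1, 2), (2, 1)}. F i j) = 0"
    by (rule balance[of _ "X 1 + X 2"], simp, simp add: X, unfold I, intro ballI impI)
      (elim insertE emptyE; simp del: One_nat_def add: X; use pqr in linarith)
  then have "F 1 2 = 0"
    using F_commute[of 1 2] by simp
  have "(\<Sum>(i, j)\<in>{(1, 3), (3, 1)}. F i j) = 0"
    by (rule balance[of _ "X 1 + X 3"], simp, simp add: X, unfold I, intro ballI impI)
      (elim insertE emptyE; simp del: One_nat_def add: X; use pqr in linarith)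
  then have "F 1 3 = 0"
    using F_commute[of 1 3] by simp
  have "(\<Sum>(i, j)\<in>{(6, 6)}. F i j) = 0"
    by (rule balance[of _ "X 6 + X 6"], simp, simp add: X, unfold I, intro ballI impI)
      (elim insertE emptyE; simp del: One_nat_def add: X; use pqr in linarith)
  then have "F 6 6 = 0"
    by simp
  have "(\<Sum>(i, j)\<in>{(5, 6), (6, 5)}. F i j) = 0"
    by (rule balance[of _ "X 5 + X 6"], simp, simp add: X, unfold I, intro ballI impI)
      (elim insertE emptyE; simp del: One_nat_def add: X; use pqr in linarith)
  then have "F 5 6 = 0"
    using F_commute[of 5 6] by simp
  \<comment> \<open>The diagonal equations fix \<open>B 1\<close> and \<open>B 6\<close> up to sign,
    and nonnegativity selects the sign. The remaining isolated equations are then linear in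
    \<open>B 2\<close>, \<open>B 5\<close>, \<open>B 3\<close>.\<close>
  have B1: "B 1 = a 1 * u"
    using \<open>F 1 1 = 0\<close> B ap ord by - (rule power2_eq_imp_eq[of "B 1"], auto simp: F_def l1 power2_eq_square simp del: One_nat_def)
  have B6: "B 6 = a 6 * v"
    using \<open>F 6 6 = 0\<close> B ap ord by - (rule power2_eq_imp_eq[of "B 6"], auto simp: F_def l6 power2_eq_square)
  have "a 1 * u * (B 2 - a 2 * (u + w) / 2) = 0"
    using \<open>F 1 2 = 0\<close> by (simp del: One_nat_def add: F_def B1 l1 l2 field_simps power2_eq_square)
  then have B2: "B 2 = a 2 * (u + w) / 2" using ap ord by simp
  have "a 6 * v * (B 5 - a 5 * (v + w) / 2) = 0"
    using \<open>F 5 6 = 0\<close> by (simp del: One_nat_def add: F_def B6 l6 l5 field_simps power2_eq_square)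
  then have B5: "B 5 = a 5 * (v + w) / 2" using ap ord by simp
  have "a 1 * (u * B 3 - a 3 * (u\<^sup>2 + s) / 2) = 0"
    using \<open>F 1 3 = 0\<close> by (simp del: One_nat_def add: F_def B1 l1 s_def field_simps)
  then have B3: "B 3 = a 3 * (u\<^sup>2 + s) / (2 * u)"
    using ap(1) ord(1) by (simp only: mult_eq_0_iff) (simp add: field_simps)
  \<comment> \<open>\<open>F 3 6\<close> vanishes exactly if \<open>s = u * v\<close>, the desired
    relation for \<open>l 3\<close>, while \<open>F 1 5\<close> and \<open>F 2 5\<close> are always
    negative.\<close>
  have F36: "F 3 6 = a 3 * a 6 * ((v - u) * (s - u * v)) / (2 * u)"
    using ord by (simp del: One_nat_def add: F_def B3 B6 l6 flip: s_def) (simp add: field_simps power2_eq_square)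
  have F15: "F 1 5 = a 1 * a 5 * ((u - w) * (v - u)) / 2"
    by (simp del: One_nat_def add: F_def B1 B5 l1 l5 field_simps power2_eq_square)
  have F25: "F 2 5 = a 2 * a 5 * ((w - u) * (w - v)) / 4"
    by (simp del: One_nat_def add: F_def B2 B5 l2 l5 field_simps power2_eq_square)
  have "(u - w) * (v - u) < 0" "(w - u) * (w - v) < 0"
    using ord by (auto intro: mult_neg_pos mult_pos_neg)
  then have F15_neg: "F 1 5 < 0" and F25_neg: "F 2 5 < 0"
    unfolding F15 F25 using ap by (simp_all add: divide_neg_pos mult_pos_neg del: One_nat_def)
  \<comment> \<open>Suppose not. If \<open>q \<ge> p\<close>, the pair 36 is isolated although
    \<open>F 3 6\<close> is nonzero. So \<open>q < p\<close>, and the negative \<open>F 1 5\<close>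
    can be balanced only by 33, which forces \<open>2 * r = 2 * p + q\<close>. This keeps 33 away
    from 25, leaving the negative \<open>F 2 5\<close> isolated.\<close>
  have r: "r = p + q"
  proof (rule ccontr)
    assume "r \<noteq> p + q"
    have "2 * X 3 \<noteq> X 1 + X 6" using \<open>r \<noteq> p + q\<close> by (simp add: X)
    then have "s \<noteq> u * v"
      unfolding X_def using ord l1 l6 s_def by (auto simp: ln_mult ln_realpow)
    then have "F 3 6 \<noteq> 0" unfolding F36 using ap ord by auto
    have "q < p"
    proof (rule ccontr)
      assume "\<not> q < p"
      have "(\<Sum>(i, j)\<in>{(3, 6), (6, 3)}. F i j) = 0"
        by (rule balance[of _ "X 3 + X 6"], simp, simp add: X, unfold I, intro ballI impI)
      (elim insertE emptyE; simp del: One_nat_def add: X; use pqr \<open>\<not> q < p\<close> in linarith)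
      then show False using \<open>F 3 6 \<noteq> 0\<close> F_commute[of 3 6] by simp
    qed
    have r'': "2 * r = 2 * p + q"
    proof (rule ccontr)
      assume r': "2 * r \<noteq> 2 * p + q"
      have "(\<Sum>(i, j)\<in>{(1, 5), (5, 1)}. F i j) = 0"
        by (rule balance[of _ "X 1 + X 5"], simp, simp add: X, unfold I, intro ballI impI)
      (elim insertE emptyE; simp del: One_nat_def add: X; use pqr r' \<open>r \<noteq> p + q\<close> \<open>q < p\<close> in linarith)
      then show False using F15_neg F_commute[of 1 5] by simp
    qed
    have "(\<Sum>(i, j)\<in>{(2, 5), (5, 2)}. F i j) = 0"
      by (rule balance[of _ "X 2 + X 5"], simp, simp add: X, unfold I, intro ballI impI)
      (elim insertE emptyE; simp del: One_nat_def add: X; use pqr r'' \<open>r \<noteq> p + q\<close> \<open>q < p\<close> in linarith)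
    then show False using F25_neg F_commute[of 2 5] by simp
  qed
  have s: "s = u * v"
  proof -
    have "2 * X 3 = X 1 + X 6" using r by (simp add: X)
    then have "ln s = ln (u * v)"
      unfolding X_def using ord l1 l6 s_def by (auto simp: ln_mult ln_realpow)
    then show ?thesis using ord by simp
  qed
  then show "(l 3)\<^sup>2 = l 1 * l 6" by (simp del: One_nat_def add: l1 l6 power_mult_distrib flip: s_def)
  have "F 3 6 = 0" by (simp add: F36 s)
  \<comment> \<open>The only possible coincidence is with 36, when \<open>p = 2 * q\<close>, and
    there \<open>F\<close> is zero.\<close>
  have "(\<Sum>(i, j)\<in>{(4, 5), (5, 4)}. F i j) = 0"
    by (rule balance[of _ "X 4 + X 5"], simp, simp add: X, unfold I, intro ballI impI)
      (elim insertE emptyE; simp del: One_nat_def add: X; use pqr r \<open>F 3 6 = 0\<close> in linarith)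
  then have "F 4 5 = 0"
    using F_commute[of 4 5] by simp
  moreover have "F 4 5 = a 5 * (v + w) / 2 * (B 4 - a 4 * w)"
    by (simp del: One_nat_def add: F_def B5 l4 l5 field_simps power2_eq_square)
  ultimately have B4: "B 4 = a 4 * w" using ap ord by simp
  have "(\<Sum>(i, j)\<in>{(1, 4), (4, 1), (2, 2)}. F i j) = 0"
    by (rule balance[of _ "X 1 + X 4"], simp, simp add: X, unfold I, intro ballI impI)
      (elim insertE emptyE; simp del: One_nat_def add: X; use pqr in linarith)
  then have "2 * F 1 4 + F 2 2 = 0"
    using F_commute[of 1 4] by simp
  moreover have "2 * F 1 4 + F 2 2 = (w - u)\<^sup>2 / 4 * ((a 2)\<^sup>2 - 4 * a 1 * a 4)"
    by (simp del: One_nat_def add: F_def B1 B2 B4 l1 l2 l4 field_simps power2_eq_square)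
  ultimately show a2: "(a 2)\<^sup>2 = 4 * a 1 * a 4" using ord by simp
  have "(\<Sum>(i, j)\<in>{(4, 6), (6, 4), (5, 5)}. F i j) = 0"
    by (rule balance[of _ "X 4 + X 6"], simp, simp add: X, unfold I, intro ballI impI)
      (elim insertE emptyE; simp del: One_nat_def add: X; use pqr in linarith)
  then have "2 * F 4 6 + F 5 5 = 0"
    using F_commute[of 4 6] by simp
  moreover have "2 * F 4 6 + F 5 5 = (v - w)\<^sup>2 / 4 * ((a 5)\<^sup>2 - 4 * a 4 * a 6)"
    by (simp del: One_nat_def add: F_def B4 B5 B6 l4 l5 l6 field_simps power2_eq_square)
  ultimately show a5: "(a 5)\<^sup>2 = 4 * a 4 * a 6" using ord by simp
  have F23: "F 2 3 = a 2 * a 3 * ((w - u) * (v - u)) / 4"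
    using ord unfolding F_def B2 B3 l2 s_def[symmetric] s by (simp add: field_simps power2_eq_square)
  \<comment> \<open>Now \<open>r = p + q\<close> makes the products 15 and 23 equal. The resulting
    relation between \<open>a 2 * a 3\<close> and \<open>a 1 * a 5\<close>, once squared, determines
    \<open>a 3\<close> through the relations for \<open>a 2\<close> and \<open>a 5\<close>.\<close>
  have "(\<Sum>(i, j)\<in>{(1, 5), (5, 1), (2, 3), (3, 2)}. F i j) = 0"
    by (rule balance[of _ "X 1 + X 5"], simp, simp add: X r, unfold I, intro ballI impI)
      (elim insertE emptyE; simp del: One_nat_def add: X; use pqr r in linarith)
  then have "F 1 5 + F 2 3 = 0"
    using F_commute[of 1 5] F_commute[of 2 3] by simp
  moreover have "F 1 5 + F 2 3 = (w - u) * (v - u) / 4 * (a 2 * a 3 - 2 * a 1 * a 5)"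
    unfolding F15 F23 by (simp add: field_simps)
  ultimately have "a 2 * a 3 = 2 * a 1 * a 5" using ord by simp
  then have "(a 2)\<^sup>2 * (a 3)\<^sup>2 = 4 * (a 1)\<^sup>2 * (a 5)\<^sup>2"
    by (metis mult.assoc power2_eq_square power_mult_distrib four_x_squared)
  then have "4 * a 1 * a 4 * ((a 3)\<^sup>2 - 4 * a 1 * a 6) = 0"
    unfolding a2 a5 by (simp add: algebra_simps power2_eq_square)
  then show "(a 3)\<^sup>2 = 4 * a 1 * a 6" using ap by simp
qed

section \<open>From the root to equations between coefficients\<close>

text \<open>Positive weights cannot cancel, so equal coefficient sums force equal sets of
  products.\<close>

lemma sum_factor_pairs_pos_iff:
  fixes f :: "'a \<Rightarrow> 'a \<Rightarrow> real" and x :: "'a \<Rightarrow> real"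
  assumes "finite K" "\<And>i j. i \<in> K \<Longrightarrow> j \<in> K \<Longrightarrow> 0 < f i j"
  shows "0 < (\<Sum>(i, j) | (i, j) \<in> K \<times> K \<and> x i * x j = z. f i j) \<longleftrightarrow>
    z \<in> (\<lambda>(i, j). x i * x j) ` (K \<times> K)"
proof
  let ?S = "{(i, j). (i, j) \<in> K \<times> K \<and> x i * x j = z}"
  assume "0 < (\<Sum>(i, j)\<in>?S. f i j)"
  then have "?S \<noteq> {}" by (metis less_irrefl sum.empty)
  then show "z \<in> (\<lambda>(i, j). x i * x j) ` (K \<times> K)" by force
next
  let ?S = "{(i, j). (i, j) \<in> K \<times> K \<and> x i * x j = z}"
  assume "z \<in> (\<lambda>(i, j). x i * x j) ` (K \<times> K)"
  then have "?S \<noteq> {}" by force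
  moreover have "finite ?S"
    by (rule finite_subset[of _ "K \<times> K"]) (use assms(1) in auto)
  ultimately show "0 < (\<Sum>(i, j)\<in>?S. f i j)"
    using assms(2) by (intro sum_pos) auto
qed

text \<open>Equal coefficients give equal product sets, hence the support of the root lies among the
  \<open>l i\<close> and its weights can be indexed by 1 to 6.\<close>

lemma square_coefficients_rigid:
  fixes a l :: "nat \<Rightarrow> real" and b :: "real \<Rightarrow> real"
  assumes a: "\<And>i. i \<in> {1..6} \<Longrightarrow> 0 < a i"
    and l: "0 < l 1" "strict_mono_on {1..6} l"
    and rel: "(l 2)\<^sup>2 = l 1 * l 4" "(l 5)\<^sup>2 = l 4 * l 6"
    and T: "finite T" "T \<subseteq> {0<..}" "\<And>t. t \<in> T \<Longrightarrow> 0 < b t"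
    and eq: "\<And>z. (\<Sum>(s, t) | (s, t) \<in> T \<times> T \<and> s * t = z. b s * b t) =
      (\<Sum>(i, j) | (i, j) \<in> {1..6} \<times> {1..6} \<and> l i * l j = z. a i * a j * (l i + l j) / 2)"
  shows "(l 3)\<^sup>2 = l 1 * l 6" "(a 2)\<^sup>2 = 4 * a 1 * a 4" "(a 3)\<^sup>2 = 4 * a 1 * a 6"
    "(a 5)\<^sup>2 = 4 * a 4 * a 6"
proof -
  have lpos: "0 < l i" if "i \<in> {1..6}" for i
    using strict_mono_on_leD[OF l(2), of 1 i] that l(1) by auto
  have inj: "inj_on l {1..6}"
    using l(2) by (rule strict_mono_on_imp_inj_on)
  have "(\<lambda>(s, t). s * t) ` (T \<times> T) = (\<lambda>(i, j). l i * l j) ` ({1..6} \<times> {1..6})"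
  proof (rule set_eqI)
    fix z
    show "z \<in> (\<lambda>(s, t). s * t) ` (T \<times> T) \<longleftrightarrow> z \<in> (\<lambda>(i, j). l i * l j) ` ({1..6} \<times> {1..6})"
      using sum_factor_pairs_pos_iff[of T "\<lambda>s t. b s * b t" "\<lambda>t. t" z]
        sum_factor_pairs_pos_iff[of "{1..6}" "\<lambda>i j. a i * a j * (l i + l j) / 2" l z]
        eq[of z] T a lpos by (simp add: add_pos_pos)
  qed
  note supp = square_support_subset[OF T(1,2) l rel this]
  \<comment> \<open>The weight is \<open>0\<close> at those \<open>l i\<close> that are not atoms of
    the root.\<close>
  define B where "B i = (if l i \<in> T then b (l i) else 0)" for i
  have B_nonneg: "0 \<le> B i" for i using T(3) by (simp add: B_def less_imp_le)
  define J where "J = {i \<in> {1..6}. l i \<in> T}"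
  have sumB: "(\<Sum>(i, j) | (i, j) \<in> {1..6} \<times> {1..6} \<and> l i * l j = z. B i * B j) =
      (\<Sum>(s, t) | (s, t) \<in> T \<times> T \<and> s * t = z. b s * b t)" for z
  proof -
    have "(\<Sum>(i, j) | (i, j) \<in> {1..6} \<times> {1..6} \<and> l i * l j = z. B i * B j) =
        (\<Sum>(i, j) | (i, j) \<in> J \<times> J \<and> l i * l j = z. b (l i) * b (l j))"
      by (rule sum.mono_neutral_cong_right)
         (auto simp: J_def B_def intro: finite_subset[of _ "{1..6} \<times> {1..6}"] split: if_splits)
    also have "\<dots> = (\<Sum>(s, t) | (s, t) \<in> T \<times> T \<and> s * t = z. b s * b t)"
    proof (rule sum.reindex_cong[of "map_prod l l", symmetric])
      show "inj_on (map_prod l l) {(i, j). (i, j) \<in> J \<times> J \<and> l i * l j = z}"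
        by (rule inj_on_subset[OF map_prod_inj_on[OF inj inj]]) (auto simp: J_def)
      show "{(s, t). (s, t) \<in> T \<times> T \<and> s * t = z} =
          map_prod l l ` {(i, j). (i, j) \<in> J \<times> J \<and> l i * l j = z}"
      proof (intro equalityI subsetI)
        fix p assume "p \<in> {(s, t). (s, t) \<in> T \<times> T \<and> s * t = z}"
        then obtain s t where p: "p = (s, t)" "s \<in> T" "t \<in> T" "s * t = z" by auto
        obtain i j where "i \<in> {1..6}" "j \<in> {1..6}" "s = l i" "t = l j"
          using p(2,3) supp(1) by blast
        with p show "p \<in> map_prod l l ` {(i, j). (i, j) \<in> J \<times> J \<and> l i * l j = z}"
          by (intro image_eqI[of _ _ "(i, j)"]) (simp_all add: J_def)
      qed (auto simp: J_def)
    qed auto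
    finally show ?thesis .
  qed
  have "(\<Sum>(i, j) | (i, j) \<in> {1..6} \<times> {1..6} \<and> l i * l j = z.
      B i * B j - a i * a j * (l i + l j) / 2) = 0" for z
    using sumB[of z] eq[of z] by (simp add: case_prod_beta sum_subtractf)
  from balanced_products_rigid[OF a l rel B_nonneg B_nonneg this]
  show "(l 3)\<^sup>2 = l 1 * l 6" "(a 2)\<^sup>2 = 4 * a 1 * a 4" "(a 3)\<^sup>2 = 4 * a 1 * a 6"
    "(a 5)\<^sup>2 = 4 * a 4 * a 6" by auto
qed

text \<open>The involution \<open>x \<mapsto> 1 / x\<close> exchanges the two cases: weighting the root by \<open>1 / t\<close> divides the
  coefficient \<open>a\<^sub>i a\<^sub>j (l\<^sub>i + l\<^sub>j)\<close> by \<open>l\<^sub>i l\<^sub>j\<close>, which gives \<open>a\<^sub>i a\<^sub>j (1 / l\<^sub>i + 1 / l\<^sub>j)\<close>.\<close>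

lemma square_coefficients_rigid_reversed:
  fixes a l :: "nat \<Rightarrow> real" and b :: "real \<Rightarrow> real"
  assumes a: "\<And>i. i \<in> {1..6} \<Longrightarrow> 0 < a i"
    and l: "0 < l 1" "strict_mono_on {1..6} l"
    and rel: "(l 2)\<^sup>2 = l 1 * l 3" "(l 5)\<^sup>2 = l 3 * l 6"
    and T: "finite T" "T \<subseteq> {0<..}" "\<And>t. t \<in> T \<Longrightarrow> 0 < b t"
    and eq: "\<And>z. (\<Sum>(s, t) | (s, t) \<in> T \<times> T \<and> s * t = z. b s * b t) =
      (\<Sum>(i, j) | (i, j) \<in> {1..6} \<times> {1..6} \<and> l i * l j = z. a i * a j * (l i + l j) / 2)"
  shows "(l 4)\<^sup>2 = l 1 * l 6" "(a 2)\<^sup>2 = 4 * a 1 * a 3" "(a 4)\<^sup>2 = 4 * a 1 * a 6"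
    "(a 5)\<^sup>2 = 4 * a 3 * a 6"
proof -
  have lpos: "0 < l i" if "i \<in> {1..6}" for i
    using strict_mono_on_leD[OF l(2), of 1 i] that l(1) by auto
  \<comment> \<open>The reversal \<open>7 - i\<close> makes the inverses increasing again and
    exchanges the indices 3 and 4, the point where the two cases differ.\<close>
  define a' where "a' i = a (7 - i)" for i
  define l' where "l' i = inverse (l (7 - i))" for i
  \<comment> \<open>For a pair with product \<open>z\<close> the two factors \<open>t\<close>
    multiply to \<open>z\<close>, which can be pulled out of the sum.\<close>
  define b' where "b' t = t * b (inverse t)" for t
  have "(\<Sum>(s, t) | (s, t) \<in> inverse ` T \<times> inverse ` T \<and> s * t = z. b' s * b' t) =
      (\<Sum>(i, j) | (i, j) \<in> {1..6} \<times> {1..6} \<and> l' i * l' j = z. a' i * a' j * (l' i + l' j) / 2)" for z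
  proof -
    have "(\<Sum>(s, t) | (s, t) \<in> inverse ` T \<times> inverse ` T \<and> s * t = z. b' s * b' t) =
        (\<Sum>(s, t) | (s, t) \<in> T \<times> T \<and> s * t = inverse z. z * (b s * b t))"
      by (rule sum.reindex_bij_witness[of _ "map_prod inverse inverse" "map_prod inverse inverse"])
         (auto simp: b'_def, metis inverse_inverse_eq inverse_mult_distrib)
    also have "\<dots> = z * (\<Sum>(s, t) | (s, t) \<in> T \<times> T \<and> s * t = inverse z. b s * b t)"
      by (simp add: sum_distrib_left case_prod_beta)
    also have "\<dots> = (\<Sum>(i, j) | (i, j) \<in> {1..6} \<times> {1..6} \<and> l i * l j = inverse z.
        z * (a i * a j * (l i + l j) / 2))"
      unfolding eq by (simp add: sum_distrib_left case_prod_beta)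
    also have "\<dots> = (\<Sum>(i, j) | (i, j) \<in> {1..6} \<times> {1..6} \<and> l' i * l' j = z.
        a' i * a' j * (l' i + l' j) / 2)"
    proof (rule sum.reindex_bij_witness[of _ "\<lambda>(i, j). (7 - i, 7 - j)" "\<lambda>(i, j). (7 - i, 7 - j)"])
      fix p assume "p \<in> {(i, j). (i, j) \<in> {1..6} \<times> {1..6} \<and> l i * l j = inverse z}"
      then obtain i j where p: "p = (i, j)" "i \<in> {1..6}" "j \<in> {1..6}" "l i * l j = inverse z" by auto
      have z: "z = inverse (l i) * inverse (l j)"
        using p(4) by (metis inverse_inverse_eq inverse_mult_distrib)
      show "(case case p of (i, j) \<Rightarrow> (7 - i, 7 - j) of (i, j) \<Rightarrow> a' i * a' j * (l' i + l' j) / 2) =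
          (case p of (i, j) \<Rightarrow> z * (a i * a j * (l i + l j) / 2))"
        using p(1-3) lpos[OF p(2)] lpos[OF p(3)] by (simp add: a'_def l'_def z field_simps)
    qed (auto simp: l'_def simp flip: inverse_mult_distrib)
    finally show ?thesis .
  qed
  note eq' = this
  have a': "0 < a' i" if "i \<in> {1..6}" for i
    unfolding a'_def by (rule a) (use that in auto)
  have l': "0 < l' 1" using lpos[of 6] by (simp add: l'_def)
  have mono': "strict_mono_on {1..6} l'"
  proof (rule strict_mono_onI)
    fix i j :: nat assume ij: "i \<in> {1..6}" "j \<in> {1..6}" "i < j"
    then have "l (7 - j) < l (7 - i)" by (intro strict_mono_onD[OF l(2)]) auto
    moreover have "0 < l (7 - j)" by (rule lpos) (use ij in auto)
    ultimately show "l' i < l' j" unfolding l'_def by (rule less_imp_inverse_less)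
  qed
  have rel': "(l' 2)\<^sup>2 = l' 1 * l' 4" "(l' 5)\<^sup>2 = l' 4 * l' 6"
    using rel by (simp_all add: l'_def power_inverse)
  have T': "finite (inverse ` T)" "inverse ` T \<subseteq> {0<..}" "\<And>t. t \<in> inverse ` T \<Longrightarrow> 0 < b' t"
    using T by (auto simp: b'_def)
  note rigid = square_coefficients_rigid[OF a' l' mono' rel' T' eq']
  have "inverse ((l 4)\<^sup>2) = inverse (l 1 * l 6)"
    using rigid(1) by (simp add: l'_def power_inverse)
  then show "(l 4)\<^sup>2 = l 1 * l 6" by (simp only: inverse_eq_iff_eq)
  show "(a 2)\<^sup>2 = 4 * a 1 * a 3" "(a 4)\<^sup>2 = 4 * a 1 * a 6" "(a 5)\<^sup>2 = 4 * a 3 * a 6"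
    using rigid(2-4) by (simp_all add: a'_def)
qed

text \<open>The pair \<open>(i, j)\<close> contributes \<open>a i * (a j * l j)\<close> to
  \<open>\<mu> * t\<mu>\<close>, which is not symmetric; averaging with the swapped pair yields the
  factor \<open>(l i + l j) / 2\<close>.\<close>

lemma square_root_convolution_coefficients:
  fixes a l :: "nat \<Rightarrow> real"
  assumes root: "has_square_root (mult_convolution (dirac_comb I a l) (t_measure (dirac_comb I a l)))"
    and I: "finite I" "I \<noteq> {}" "\<And>i. i \<in> I \<Longrightarrow> 0 < a i" "\<And>i. i \<in> I \<Longrightarrow> 0 < l i"
  obtains T b where "finite T" "T \<subseteq> {0<..}" "\<And>t. t \<in> T \<Longrightarrow> 0 < b t"
    "\<And>z. (\<Sum>(s, t) | (s, t) \<in> T \<times> T \<and> s * t = z. b s * b t) =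
      (\<Sum>(i, j) | (i, j) \<in> I \<times> I \<and> l i * l j = z. a i * a j * (l i + l j) / 2)"
proof -
  have nn: "0 \<le> a i" "0 \<le> l i" if "i \<in> I" for i using I that by (auto simp: less_imp_le)
  let ?E = "dirac_comb (I \<times> I) (\<lambda>(i, j). a i * (a j * l j)) (\<lambda>(i, j). l i * l j)"
  have E: "mult_convolution (dirac_comb I a l) (t_measure (dirac_comb I a l)) = ?E"
    using I(1) nn by (simp add: t_measure_dirac_comb mult_convolution_dirac_comb)
  obtain T b where T: "finite T" "T \<subseteq> {0<..}" "\<And>t. t \<in> T \<Longrightarrow> 0 < b t"
    and conv: "mult_convolution (dirac_comb T b (\<lambda>t. t)) (dirac_comb T b (\<lambda>t. t)) = ?E"
    using root unfolding E by (rule square_root_dirac_combE) (use I in auto)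
  have bnn: "0 \<le> b t" if "t \<in> T" for t using T(3)[OF that] by simp
  have "(\<Sum>(s, t) | (s, t) \<in> T \<times> T \<and> s * t = z. b s * b t) =
      (\<Sum>(i, j) | (i, j) \<in> I \<times> I \<and> l i * l j = z. a i * a j * (l i + l j) / 2)" for z
  proof -
    let ?S = "{(i, j). (i, j) \<in> I \<times> I \<and> l i * l j = z}"
    have "(\<Sum>(s, t) | (s, t) \<in> T \<times> T \<and> s * t = z. b s * b t) =
        measure (dirac_comb (T \<times> T) (\<lambda>(s, t). b s * b t) (\<lambda>(s, t). s * t)) {z}"
      using T(1) bnn by (subst measure_dirac_comb_singleton) (auto intro!: sum.cong)
    also have "dirac_comb (T \<times> T) (\<lambda>(s, t). b s * b t) (\<lambda>(s, t). s * t) = ?E"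
      using T(1) bnn by (simp add: mult_convolution_dirac_comb flip: conv)
    also have "measure ?E {z} = (\<Sum>(i, j)\<in>?S. a i * (a j * l j))"
      using I(1) nn by (subst measure_dirac_comb_singleton) (auto intro!: sum.cong)
    finally have 1: "(\<Sum>(s, t) | (s, t) \<in> T \<times> T \<and> s * t = z. b s * b t) = (\<Sum>(i, j)\<in>?S. a i * (a j * l j))" .
    also have "\<dots> = (\<Sum>(i, j)\<in>?S. a j * (a i * l i))"
      by (rule sum.reindex_bij_witness[of _ prod.swap prod.swap]) (auto simp: mult.commute)
    finally have 2: "(\<Sum>(s, t) | (s, t) \<in> T \<times> T \<and> s * t = z. b s * b t) = (\<Sum>(i, j)\<in>?S. a j * (a i * l i))" .
    have "2 * (\<Sum>(s, t) | (s, t) \<in> T \<times> T \<and> s * t = z. b s * b t) =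
        (\<Sum>(i, j)\<in>?S. a i * (a j * l j) + a j * (a i * l i))"
      using 1 2 by (simp add: case_prod_beta sum.distrib)
    also have "\<dots> = 2 * (\<Sum>(i, j)\<in>?S. a i * a j * (l i + l j) / 2)"
      unfolding sum_distrib_left by (intro sum.cong) (auto simp: algebra_simps)
    finally show ?thesis by simp
  qed
  from that[of T b, OF T this] show ?thesis .
qed

theorem proposition4p3:
  fixes \<mu> :: "real measure" and a l :: "nat \<Rightarrow> real"
  assumes "\<mu> = dirac_comb {1..6} a l"
    and "prob_space \<mu>"
    and "\<forall>i\<in>{1..6}. 0 < a i"
    and "0 < l 1"
    and "strict_mono_on {1..6} l"
  shows
    "((l 2)\<^sup>2 = l 1 * l 4 \<and> (l 5)\<^sup>2 = l 4 * l 6 \<longrightarrow>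
       (has_square_root (mult_convolution \<mu> (t_measure \<mu>)) \<longleftrightarrow>
         (l 3)\<^sup>2 = l 1 * l 6 \<and>
         ((a 2)\<^sup>2, (a 3)\<^sup>2, (a 5)\<^sup>2) = (4 * a 1 * a 4, 4 * a 1 * a 6, 4 * a 4 * a 6)) \<and>
       ((l 3)\<^sup>2 = l 1 * l 6 \<and>
         ((a 2)\<^sup>2, (a 3)\<^sup>2, (a 5)\<^sup>2) = (4 * a 1 * a 4, 4 * a 1 * a 6, 4 * a 4 * a 6) \<longleftrightarrow>
        has_square_root \<mu>)) \<and>
     ((l 2)\<^sup>2 = l 1 * l 3 \<and> (l 5)\<^sup>2 = l 3 * l 6 \<longrightarrow>
       (has_square_root (mult_convolution \<mu> (t_measure \<mu>)) \<longleftrightarrow>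
         (l 4)\<^sup>2 = l 1 * l 6 \<and>
         ((a 2)\<^sup>2, (a 4)\<^sup>2, (a 5)\<^sup>2) = (4 * a 1 * a 3, 4 * a 1 * a 6, 4 * a 3 * a 6)) \<and>
       ((l 4)\<^sup>2 = l 1 * l 6 \<and>
         ((a 2)\<^sup>2, (a 4)\<^sup>2, (a 5)\<^sup>2) = (4 * a 1 * a 3, 4 * a 1 * a 6, 4 * a 3 * a 6) \<longleftrightarrow>
        has_square_root \<mu>))"

proof -
  \<comment> \<open>The three atoms whose square roots carry the root come first, followed by the
    mixed products in the order used by \<open>has_square_root_three_atoms\<close>.\<close>
  have I: "{1..6} = {1, 4, 6, 2, 5, 3 :: nat}" "{1..6} = {1, 3, 6, 2, 5, 4 :: nat}" by auto
  have a: "0 < a i" and l: "0 < l i" if "i \<in> {1..6}" for i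
    using that assms(3,4) strict_mono_on_leD[OF assms(5), of 1 i] by auto
  have root\<mu>: "has_square_root (mult_convolution \<mu> (t_measure \<mu>))" if "has_square_root \<mu>"
    using that unfolding assms(1) by (rule has_square_root_convolution_t_measure) (auto simp: a l)
  note necessary = square_root_convolution_coefficients[of "{1..6}" a l, folded assms(1)]
  have 1: "(l 3)\<^sup>2 = l 1 * l 6 \<and> ((a 2)\<^sup>2, (a 3)\<^sup>2, (a 5)\<^sup>2) = (4 * a 1 * a 4, 4 * a 1 * a 6, 4 * a 4 * a 6)"
    if rel: "(l 2)\<^sup>2 = l 1 * l 4" "(l 5)\<^sup>2 = l 4 * l 6" and "has_square_root (mult_convolution \<mu> (t_measure \<mu>))"
  proof (rule necessary)
    fix T b assume "finite T" "T \<subseteq> {0<..}" "\<And>t. t \<in> T \<Longrightarrow> 0 < b t"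
      "\<And>z. (\<Sum>(s, t) | (s, t) \<in> T \<times> T \<and> s * t = z. b s * b t) =
        (\<Sum>(i, j) | (i, j) \<in> {1..6} \<times> {1..6} \<and> l i * l j = z. a i * a j * (l i + l j) / 2)"
    from square_coefficients_rigid[of a l, OF a assms(4,5) rel this] show ?thesis by simp
  qed (use that a l in auto)
  have 2: "(l 4)\<^sup>2 = l 1 * l 6 \<and> ((a 2)\<^sup>2, (a 4)\<^sup>2, (a 5)\<^sup>2) = (4 * a 1 * a 3, 4 * a 1 * a 6, 4 * a 3 * a 6)"
    if rel: "(l 2)\<^sup>2 = l 1 * l 3" "(l 5)\<^sup>2 = l 3 * l 6" and "has_square_root (mult_convolution \<mu> (t_measure \<mu>))"
  proof (rule necessary)
    fix T b assume "finite T" "T \<subseteq> {0<..}" "\<And>t. t \<in> T \<Longrightarrow> 0 < b t"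
      "\<And>z. (\<Sum>(s, t) | (s, t) \<in> T \<times> T \<and> s * t = z. b s * b t) =
        (\<Sum>(i, j) | (i, j) \<in> {1..6} \<times> {1..6} \<and> l i * l j = z. a i * a j * (l i + l j) / 2)"
    from square_coefficients_rigid_reversed[of a l, OF a assms(4,5) rel this] show ?thesis by simp
  qed (use that a l in auto)
  have 3: "has_square_root \<mu>"
    if "(l 2)\<^sup>2 = l 1 * l 4" "(l 5)\<^sup>2 = l 4 * l 6" "(l 3)\<^sup>2 = l 1 * l 6"
      "((a 2)\<^sup>2, (a 3)\<^sup>2, (a 5)\<^sup>2) = (4 * a 1 * a 4, 4 * a 1 * a 6, 4 * a 4 * a 6)"
    unfolding assms(1) I(1)
    by (rule has_square_root_three_atoms) (use that a l in \<open>auto simp: less_imp_le\<close>)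
  have 4: "has_square_root \<mu>"
    if "(l 2)\<^sup>2 = l 1 * l 3" "(l 5)\<^sup>2 = l 3 * l 6" "(l 4)\<^sup>2 = l 1 * l 6"
      "((a 2)\<^sup>2, (a 4)\<^sup>2, (a 5)\<^sup>2) = (4 * a 1 * a 3, 4 * a 1 * a 6, 4 * a 3 * a 6)"
    unfolding assms(1) I(2)
    by (rule has_square_root_three_atoms) (use that a l in \<open>auto simp: less_imp_le\<close>)
  \<comment> \<open>Facts \<open>1\<close> and \<open>2\<close> give (1) to (2), \<open>3\<close>
    and \<open>4\<close> give (2) to (3), and \<open>root\<mu>\<close> closes the cycle.\<close>
  show ?thesis
    using 1 2 3 4 root\<mu> by metis
qed

end
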